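(* For each integer $n\ge 1$ let $C_n^\star=\{(x_1,\dots,x_n)\in\mathbb{R}^n: \sum_{i=1}^n|x_i|\leq 1\}$. Let $c_3=0.2056\cdots$ be the solution of $\frac{1}{2^{1-c}}\cdot\frac{(1+c)^{1+c}}{c^c}=1$, and let $c_4=0.2271\cdots$ be the solution in $(0,1)$ of $\frac{1}{2^{1-c}}\cdot\frac{1}{c^c\,(1-c)^{1-c}}=1$. Then there exists a real number $c_2$ with $c_3\leq c_2\leq c_4$ such that $$\lim_{n\to\infty}\gamma_{2^n}(C_n^\star)\leq \frac{1}{1+c_2}.$$
   Context: For a convex body $K\subset\mathbb{R}^n$ (a compact convex set with non-empty interior) and a positive integer $m$, Hadwiger's covering functional is $$\gamma_m(K)=\min\Big\{\lambda>0:\ \exists\, u_1,\dots,u_m\in\mathbb{R}^n \text{ such that } K\subseteq \bigcup_{i=1}^m(\lambda K+u_i)\Big\},$$ i.e. the smallest $\lambda$ such that $K$ can be covered by $m$ translates of $\lambda K$. *)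

theory Defs
  imports Complex_Main "Jordan_Normal_Form.Matrix"
begin

(* R^n is carrier_vec n, so that n can be an ordinary natural number.  The minimum is
   written with LEAST and not as an infimum: that it is attained for a convex body K is
   part of the meaning of the notion, and must be proved in order to use it. *)
definition hadwiger_gamma :: "nat \<Rightarrow> nat \<Rightarrow> real vec set \<Rightarrow> real" where
  "hadwiger_gamma n m K =
     (LEAST r. 0 < r \<and>
        (\<exists>u. (\<forall>i\<in>{1..m}. u i \<in> carrier_vec n) \<and>
             K \<subseteq> (\<Union>i\<in>{1..m}. (\<lambda>x. r \<cdot>\<^sub>v x + u i) ` K)))"

(* The coordinates of a vector in carrier_vec n are indexed by 0, ..., n - 1. *)
definition cross_polytope :: "nat \<Rightarrow> real vec set" where
  "cross_polytope n = {x \<in> carrier_vec n. (\<Sum>i<n. \<bar>x $ i\<bar>) \<le> 1}"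

(* c powr c is the real power c^c only for c > 0 (0 powr 0 = 0 in HOL), and c^c is not real
   in general for c < 0; hence the explicit domain c > 0 in the first equation. *)
definition is_c3 :: "real \<Rightarrow> bool" where
  "is_c3 c \<longleftrightarrow> 0 < c \<and>
     1 / 2 powr (1 - c) * ((1 + c) powr (1 + c) / c powr c) = 1"

definition is_c4 :: "real \<Rightarrow> bool" where
  "is_c4 c \<longleftrightarrow> 0 < c \<and> c < 1 \<and>
     1 / 2 powr (1 - c) * (1 / (c powr c * (1 - c) powr (1 - c))) = 1"

definition c3 :: real where
  "c3 = (THE c. is_c3 c)"

definition c4 :: real where
  "c4 = (THE c. is_c4 c)"

end

theory Submission
  imports Defs
begin

text \<open>Upper bound: with \<open>k = \<lfloor>c\<^sub>3 n\<rfloor>\<close>, every point of \<open>(n + k) C\<close>, for \<open>C\<close> the cross-polytope in dimension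
  \<open>n\<close>, is within \<open>l\<^sub>1\<close>-distance \<open>n\<close> of an integer vector of norm at most \<open>k\<close>.  An exponential moment
  bound shows that there are at most \<open>2 ^ n\<close> such vectors, by the choice of \<open>c\<^sub>3\<close>; hence the functional
  is at most \<open>n / (n + k)\<close>, which tends to \<open>1 / (1 + c\<^sub>3)\<close>, and \<open>c\<^sub>2 = c\<^sub>3\<close> will do.

  Existence of the limit: a cover in dimension \<open>n\<close> yields covers in all large dimensions \<open>M\<close>, by
  cutting the coordinates into blocks of length \<open>n\<close>, rounding the masses of the blocks and covering
  the blocks independently.  Rounding costs a factor exponential in the number \<open>M / n\<close> of blocks,
  which is compensated by ignoring a fraction \<open>1 / l\<close> of the coordinates of mass at most \<open>1 / l\<close>.  So
  each value of the sequence almost dominates all sufficiently late ones.\<close>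

section \<open>Coverings of cross-polytopes in growing dimensions\<close>

text \<open>An arbitrary index set lets coordinates be grouped into blocks, as products of index
  sets, and blocks be dropped without renumbering. Centers form a set with at most \<open>m\<close>
  elements, so merging or repeating centers needs no bookkeeping.\<close>

definition l1_cover :: "'i set \<Rightarrow> nat \<Rightarrow> real \<Rightarrow> bool" where
  "l1_cover I m r \<longleftrightarrow> (\<exists>U. finite U \<and> card U \<le> m \<and>
     (\<forall>x::'i \<Rightarrow> real. (\<Sum>i\<in>I. \<bar>x i\<bar>) \<le> 1 \<longrightarrow> (\<exists>u\<in>U. (\<Sum>i\<in>I. \<bar>x i - u i\<bar>) \<le> r)))"

lemma l1_cover_mono:
  assumes "l1_cover I m r" "m \<le> m'" "r \<le> r'"
  shows "l1_cover I m' r'"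
  using assms unfolding l1_cover_def by (meson order_trans)

lemma l1_cover_one:
  assumes "m \<ge> 1"
  shows "l1_cover I m 1"
  unfolding l1_cover_def using assms by (intro exI[of _ "{\<lambda>_. 0}"]) auto

text \<open>The ball over \<open>I\<close> embeds isometrically, by an injection \<open>f\<close>
  and extension by zero, into the ball over \<open>J\<close>. Pulling the centers back along
  \<open>f\<close> only discards nonnegative terms of the distance.\<close>

lemma l1_cover_reindex:
  fixes I :: "'i set" and J :: "'j set"
  assumes fin: "finite I" "finite J" and le: "card I \<le> card J" and cov: "l1_cover J m r"
  shows "l1_cover I m r"
proof -
  obtain f where f: "inj_on f I" "f ` I \<subseteq> J"
    using card_le_inj[OF fin le] by blast
  obtain U where U: "finite U" "card U \<le> m"
    "\<And>y. (\<Sum>j\<in>J. \<bar>y j\<bar>) \<le> 1 \<Longrightarrow> \<exists>u\<in>U. (\<Sum>j\<in>J. \<bar>y j - u j\<bar>) \<le> r"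
    using cov unfolding l1_cover_def by blast
  have "\<exists>u\<in>(\<lambda>u. u \<circ> f) ` U. (\<Sum>i\<in>I. \<bar>x i - u i\<bar>) \<le> r"
    if x: "(\<Sum>i\<in>I. \<bar>x i\<bar>) \<le> 1" for x :: "'i \<Rightarrow> real"
  proof -
    define y where "y j = (if j \<in> f ` I then x (the_inv_into I f j) else 0)" for j
    have yf: "y (f i) = x i" if "i \<in> I" for i
      using that f(1) by (simp add: y_def the_inv_into_f_f)
    have "(\<Sum>j\<in>J. \<bar>y j\<bar>) = (\<Sum>j\<in>f ` I. \<bar>y j\<bar>)"
      using fin f(2) by (intro sum.mono_neutral_right) (auto simp: y_def)
    also have "\<dots> = (\<Sum>i\<in>I. \<bar>x i\<bar>)"
      using yf by (simp add: sum.reindex[OF f(1)])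
    finally obtain u where u: "u \<in> U" "(\<Sum>j\<in>J. \<bar>y j - u j\<bar>) \<le> r"
      using U(3)[of y] x by auto
    have "(\<Sum>i\<in>I. \<bar>x i - (u \<circ> f) i\<bar>) = (\<Sum>j\<in>f ` I. \<bar>y j - u j\<bar>)"
      using yf by (simp add: sum.reindex[OF f(1)])
    also have "\<dots> \<le> (\<Sum>j\<in>J. \<bar>y j - u j\<bar>)"
      using fin f(2) by (intro sum_mono2) auto
    finally show ?thesis
      using u by (intro bexI[of _ "u \<circ> f"]) auto
  qed
  moreover have "finite ((\<lambda>u. u \<circ> f) ` U)" "card ((\<lambda>u. u \<circ> f) ` U) \<le> m"
    using U(1,2) card_image_le[OF U(1)] order_trans by auto
  ultimately show ?thesis
    unfolding l1_cover_def by blast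
qed

text \<open>In every point of the ball one of the \<open>l + 1\<close> blocks carries mass at most \<open>1 / (l + 1)\<close>, and
  it may be approximated by zero.  Dropping it costs only the factor \<open>l + 1\<close> in the number of
  translates, whereas it reduces the dimension by a fixed proportion.\<close>

lemma l1_cover_drop_block:
  fixes J :: "'j set"
  assumes fin: "finite J" and cov: "l1_cover ({..<l} \<times> J) m r"
  shows "l1_cover ({..<Suc l} \<times> J) (Suc l * m) (r + 1 / Suc l)"
proof -
  define R where "R c = ({..<Suc l} - {c}) \<times> J" for c
  have "l1_cover (R c) m r" if "c < Suc l" for c
    unfolding R_def using that
    by (intro l1_cover_reindex[OF _ _ _ cov]) (auto simp: fin)
  then have "\<forall>c\<in>{..<Suc l}. \<exists>U. finite U \<and> card U \<le> m \<and>
     (\<forall>x::nat \<times> 'j \<Rightarrow> real. (\<Sum>i\<in>R c. \<bar>x i\<bar>) \<le> 1 \<longrightarrow> (\<exists>u\<in>U. (\<Sum>i\<in>R c. \<bar>x i - u i\<bar>) \<le> r))"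
    unfolding l1_cover_def by auto
  then obtain U where U: "\<And>c. c < Suc l \<Longrightarrow> finite (U c) \<and> card (U c) \<le> m \<and>
     (\<forall>x::nat \<times> 'j \<Rightarrow> real. (\<Sum>i\<in>R c. \<bar>x i\<bar>) \<le> 1 \<longrightarrow> (\<exists>u\<in>U c. (\<Sum>i\<in>R c. \<bar>x i - u i\<bar>) \<le> r))"
    unfolding bchoice_iff by auto
  \<comment> \<open>Centers are set to zero on block \<open>c\<close>, so that this block adds
    exactly its own mass to the distance.\<close>
  define Z where "Z c u = (\<lambda>i. if i \<in> R c then u i else (0::real))" for c u
  define W where "W = (\<Union>c<Suc l. Z c ` U c)"
  have finR: "finite (R c)" for c
    using fin by (simp add: R_def)
  have "finite W"
    using U by (auto simp: W_def)
  moreover have "card W \<le> Suc l * m"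
  proof -
    have "card W \<le> (\<Sum>c<Suc l. card (Z c ` U c))"
      unfolding W_def by (intro card_UN_le) auto
    also have "\<dots> \<le> (\<Sum>c<Suc l. m)"
      using U card_image_le order_trans by (intro sum_mono) blast
    finally show ?thesis by simp
  qed
  moreover have "\<exists>w\<in>W. (\<Sum>i\<in>{..<Suc l} \<times> J. \<bar>x i - w i\<bar>) \<le> r + 1 / Suc l"
    if x: "(\<Sum>i\<in>{..<Suc l} \<times> J. \<bar>x i\<bar>) \<le> 1" for x :: "nat \<times> 'j \<Rightarrow> real"
  proof -
    define t where "t c = (\<Sum>j\<in>J. \<bar>x (c, j)\<bar>)" for c
    have "\<exists>c<Suc l. t c \<le> 1 / Suc l"
    proof (rule ccontr)
      assume "\<not> ?thesis"
      then have "(\<Sum>c<Suc l. 1 / Suc l) < (\<Sum>c<Suc l. t c)"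
        by (intro sum_strict_mono) auto
      also have "\<dots> \<le> 1"
        using x by (simp add: t_def sum.cartesian_product case_prod_unfold)
      finally show False by simp
    qed
    then obtain c where c: "c < Suc l" "t c \<le> 1 / Suc l" by auto
    have split: "(\<Sum>i\<in>{..<Suc l} \<times> J. f i) = (\<Sum>i\<in>R c. f i) + (\<Sum>j\<in>J. f (c, j))"
      for f :: "nat \<times> 'j \<Rightarrow> real"
    proof -
      have "{..<Suc l} \<times> J = R c \<union> Pair c ` J" "R c \<inter> Pair c ` J = {}"
        using c(1) by (auto simp: R_def)
      then have "(\<Sum>i\<in>{..<Suc l} \<times> J. f i) = (\<Sum>i\<in>R c. f i) + (\<Sum>i\<in>Pair c ` J. f i)"
        using fin finR by (simp add: sum.union_disjoint)
      then show ?thesis by (simp add: sum.reindex inj_on_def)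
    qed
    have "(\<Sum>i\<in>R c. \<bar>x i\<bar>) \<le> 1"
      using x split[of "\<lambda>i. \<bar>x i\<bar>"] sum_nonneg[of J "\<lambda>j. \<bar>x (c, j)\<bar>"] by linarith
    then obtain u where u: "u \<in> U c" "(\<Sum>i\<in>R c. \<bar>x i - u i\<bar>) \<le> r"
      using U[OF c(1)] by blast
    have "(\<Sum>i\<in>{..<Suc l} \<times> J. \<bar>x i - Z c u i\<bar>)
        = (\<Sum>i\<in>R c. \<bar>x i - u i\<bar>) + t c"
      unfolding split t_def by (intro arg_cong2[of _ _ _ _ "(+)"] sum.cong) (auto simp: Z_def R_def)
    with u c show ?thesis
      by (intro bexI[of _ "Z c u"]) (auto simp: W_def)
  qed
  ultimately show ?thesis
    unfolding l1_cover_def by blast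
qed

section \<open>Counting profiles and covering block by block\<close>

text \<open>Exponential moment bound: since \<open>q \<le> 1\<close>, each counted \<open>z\<close>
  contributes at least \<open>q ^ k\<close> to the sum of \<open>q\<close> to the total weight, and
  over all functions this sum factors into equal coordinate sums.\<close>

lemma card_weight_le:
  fixes q :: real and w :: "'b \<Rightarrow> nat"
  assumes "finite I" "finite B" "0 < q" "q \<le> 1"
  shows "card {z \<in> I \<rightarrow>\<^sub>E B. (\<Sum>i\<in>I. w (z i)) \<le> k} * q ^ k \<le> (\<Sum>b\<in>B. q ^ w b) ^ card I"
proof -
  let ?Z = "{z \<in> I \<rightarrow>\<^sub>E B. (\<Sum>i\<in>I. w (z i)) \<le> k}"
  have fin: "finite (I \<rightarrow>\<^sub>E B)"
    using assms by (intro finite_PiE)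
  have "card ?Z * q ^ k = (\<Sum>z\<in>?Z. q ^ k)" by simp
  also have "\<dots> \<le> (\<Sum>z\<in>?Z. q ^ (\<Sum>i\<in>I. w (z i)))"
    using assms by (intro sum_mono power_decreasing) auto
  also have "\<dots> \<le> (\<Sum>z\<in>I \<rightarrow>\<^sub>E B. q ^ (\<Sum>i\<in>I. w (z i)))"
    using assms fin by (intro sum_mono2) auto
  also have "\<dots> = (\<Sum>z\<in>I \<rightarrow>\<^sub>E B. \<Prod>i\<in>I. q ^ w (z i))"
    by (simp add: power_sum)
  also have "\<dots> = (\<Sum>b\<in>B. q ^ w b) ^ card I"
    using prod_sum_PiE[of I "\<lambda>_. B" "\<lambda>_ b. q ^ w b"] assms by simp
  finally show ?thesis .
qed

text \<open>The weight 1/2 is used, for which the geometric series is at most 2.\<close>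

lemma card_bounded_sum_le:
  "card {a \<in> {..<Q} \<rightarrow>\<^sub>E {..B::nat}. (\<Sum>i<Q. a i) \<le> k} \<le> 2 ^ (k + Q)"
proof -
  let ?c = "card {a \<in> {..<Q} \<rightarrow>\<^sub>E {..B::nat}. (\<Sum>i<Q. a i) \<le> k}"
  have geom: "(\<Sum>b\<le>B. (1/2::real) ^ b) \<le> 2"
    by (simp add: sum_gp0)
  have "?c * (1/2::real) ^ k \<le> (\<Sum>b\<le>B. (1/2) ^ b) ^ Q"
    using card_weight_le[of "{..<Q}" "{..B}" "1/2" "\<lambda>b. b" k] by simp
  also have "\<dots> \<le> 2 ^ Q"
    using geom by (intro power_mono) (auto intro: sum_nonneg)
  finally have "real ?c \<le> 2 ^ k * 2 ^ Q"
    by (simp add: field_simps)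
  then have "real ?c \<le> real (2 ^ (k + Q))"
    by (simp only: of_nat_mult of_nat_power of_nat_numeral power_add)
  then show ?thesis by (simp only: of_nat_le_iff)
qed

text \<open>The masses of the \<open>Q\<close> blocks are rounded up to multiples of \<open>1 / (Q A)\<close>, so that only
  exponentially many (in \<open>Q\<close>) mass profiles \<open>a\<close> occur; for a fixed profile the blocks are covered
  independently of each other.\<close>

lemma l1_cover_product:
  fixes n m Q A :: nat
  assumes cov: "l1_cover {..<n} m r" and r: "r > 0" and Q: "Q > 0" and A: "A > 0"
  shows "l1_cover ({..<Q} \<times> {..<n}) (2 ^ ((A + 2) * Q) * m ^ Q) (r * (1 + 1 / A))"
proof -
  obtain U where U: "finite U" "card U \<le> m"
    "\<And>x. (\<Sum>i<n. \<bar>x i\<bar>) \<le> 1 \<Longrightarrow> \<exists>u\<in>U. (\<Sum>i<n. \<bar>x i - u i\<bar>) \<le> r"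
    using cov unfolding l1_cover_def by blast
  \<comment> \<open>This center serves the blocks of mass zero, where division by the mass is
    impossible.\<close>
  obtain u0 where u0: "u0 \<in> U"
    using U(3)[of "\<lambda>_. 0"] by auto
  have scaled: "\<exists>u\<in>U. (\<Sum>i<n. \<bar>x i - s * u i\<bar>) \<le> r * s" if x: "(\<Sum>i<n. \<bar>x i\<bar>) \<le> s" for x s
  proof (cases "s > 0")
    case True
    have "(\<Sum>i<n. \<bar>x i / s\<bar>) = (\<Sum>i<n. \<bar>x i\<bar>) / s"
      using True by (simp add: sum_divide_distrib)
    also have "\<dots> \<le> 1" using x True by simp
    finally obtain u where u: "u \<in> U" "(\<Sum>i<n. \<bar>x i / s - u i\<bar>) \<le> r"
      using U(3)[of "\<lambda>i. x i / s"] by blast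
    have "(\<Sum>i<n. \<bar>x i - s * u i\<bar>) = (\<Sum>i<n. s * \<bar>x i / s - u i\<bar>)"
    proof (rule sum.cong[OF refl])
      fix i
      have "s * \<bar>x i / s - u i\<bar> = \<bar>s * (x i / s - u i)\<bar>"
        using True by (simp add: abs_mult)
      also have "s * (x i / s - u i) = x i - s * u i"
        using True by (simp add: field_simps)
      finally show "\<bar>x i - s * u i\<bar> = s * \<bar>x i / s - u i\<bar>" by simp
    qed
    also have "\<dots> = s * (\<Sum>i<n. \<bar>x i / s - u i\<bar>)"
      by (simp add: sum_distrib_left)
    also have "\<dots> \<le> r * s"
      using u(2) True by (simp add: mult.commute)
    finally show ?thesis using u(1) by blast
  next
    case False
    have "0 \<le> (\<Sum>i<n. \<bar>x i\<bar>)" by (simp add: sum_nonneg)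
    with False x have "s = 0" by linarith
    with x u0 show ?thesis by auto
  qed
  define D :: real where "D = real Q * real A"
  have D: "D > 0" using Q A by (simp add: D_def)
  \<comment> \<open>In units of \<open>1 / D\<close> the total mass 1 is \<open>Q * A\<close>, which
    also bounds each single block; rounding up adds at most one unit for each of the
    \<open>Q\<close> blocks.\<close>
  define S where "S = {a \<in> {..<Q} \<rightarrow>\<^sub>E {..Q * A}. (\<Sum>i<Q. a i) \<le> (A + 1) * Q}"
  define G where "G = {..<Q} \<rightarrow>\<^sub>E U"
  define w where "w = (\<lambda>(a::nat \<Rightarrow> nat, g) (i, j). a i / D * (g i :: nat \<Rightarrow> real) j)"
  have finS: "finite S"
    unfolding S_def by (rule finite_subset[of _ "{..<Q} \<rightarrow>\<^sub>E {..Q * A}"]) (auto intro: finite_PiE)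
  have finG: "finite G"
    unfolding G_def using U(1) by (intro finite_PiE) auto
  have "finite (w ` (S \<times> G))" using finS finG by auto
  moreover have "card (w ` (S \<times> G)) \<le> 2 ^ ((A + 2) * Q) * m ^ Q"
  proof -
    have "card (w ` (S \<times> G)) \<le> card S * card G"
      using card_image_le[of "S \<times> G" w] finS finG by (simp add: card_cartesian_product)
    also have "card S \<le> 2 ^ ((A + 1) * Q + Q)"
      unfolding S_def by (rule card_bounded_sum_le)
    also have "card G \<le> m ^ Q"
      unfolding G_def using U(2) by (simp add: card_PiE power_mono)
    finally show ?thesis by (simp add: algebra_simps)
  qed
  moreover have "\<exists>v\<in>w ` (S \<times> G). (\<Sum>i\<in>{..<Q} \<times> {..<n}. \<bar>x i - v i\<bar>) \<le> r * (1 + 1 / A)"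
    if x: "(\<Sum>i\<in>{..<Q} \<times> {..<n}. \<bar>x i\<bar>) \<le> 1" for x :: "nat \<times> nat \<Rightarrow> real"
  proof -
    define t where "t i = (\<Sum>j<n. \<bar>x (i, j)\<bar>)" for i
    have t0: "t i \<ge> 0" for i by (simp add: t_def sum_nonneg)
    have sumt: "(\<Sum>i<Q. t i) \<le> 1"
      using x by (simp add: t_def sum.cartesian_product case_prod_unfold)
    have t1: "t i \<le> 1" if "i < Q" for i
      using member_le_sum[of i "{..<Q}" t] that t0 sumt by auto
    define a where "a = (\<lambda>i\<in>{..<Q}. nat \<lceil>t i * D\<rceil>)"
    have a_ge: "t i * D \<le> a i" if "i < Q" for i
      using that by (simp add: a_def) linarith
    have a_le: "a i \<le> t i * D + 1" if "i < Q" for i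
    proof -
      have "t i * D \<ge> 0" using t0 D by simp
      then have "\<lceil>t i * D\<rceil> \<ge> 0" by linarith
      then show ?thesis using that by (simp add: a_def)
    qed
    have suma: "(\<Sum>i<Q. real (a i)) \<le> D + Q"
    proof -
      have "(\<Sum>i<Q. real (a i)) \<le> (\<Sum>i<Q. t i * D + 1)"
        using a_le by (intro sum_mono) auto
      also have "\<dots> = (\<Sum>i<Q. t i) * D + Q"
        by (simp add: sum.distrib sum_distrib_right)
      also have "\<dots> \<le> D + Q" using sumt D by simp
      finally show ?thesis .
    qed
    have "a i \<le> Q * A" if "i < Q" for i
    proof -
      have "t i * D \<le> D" using t1[OF that] D by simp
      then have "t i * D \<le> real (Q * A)" by (simp add: D_def)
      then show ?thesis using that by (simp add: a_def nat_le_iff ceiling_le_iff)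
    qed
    moreover have "(\<Sum>i<Q. a i) \<le> (A + 1) * Q"
    proof -
      have "real (\<Sum>i<Q. a i) \<le> real ((A + 1) * Q)"
        using suma by (simp add: D_def algebra_simps)
      then show ?thesis by (simp only: of_nat_le_iff)
    qed
    ultimately have aS: "a \<in> S"
      by (auto simp: S_def a_def PiE_def)
    have "\<forall>i\<in>{..<Q}. \<exists>u. u \<in> U \<and> (\<Sum>j<n. \<bar>x (i, j) - a i / D * u j\<bar>) \<le> r * (a i / D)"
    proof
      fix i assume "i \<in> {..<Q}"
      then have "(\<Sum>j<n. \<bar>x (i, j)\<bar>) \<le> a i / D"
        using a_ge[of i] D by (simp add: t_def field_simps)
      from scaled[OF this] show "\<exists>u. u \<in> U \<and> (\<Sum>j<n. \<bar>x (i, j) - a i / D * u j\<bar>) \<le> r * (a i / D)"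
        by blast
    qed
    then obtain g0 where g0: "\<And>i. i < Q \<Longrightarrow> g0 i \<in> U"
      "\<And>i. i < Q \<Longrightarrow> (\<Sum>j<n. \<bar>x (i, j) - a i / D * g0 i j\<bar>) \<le> r * (a i / D)"
      unfolding bchoice_iff by auto
    define g where "g = restrict g0 {..<Q}"
    have gG: "g \<in> G" using g0(1) by (auto simp: G_def g_def)
    have "(\<Sum>i\<in>{..<Q} \<times> {..<n}. \<bar>x i - w (a, g) i\<bar>)
        = (\<Sum>i<Q. \<Sum>j<n. \<bar>x (i, j) - a i / D * g0 i j\<bar>)"
      by (auto simp: sum.cartesian_product w_def g_def case_prod_unfold intro!: sum.cong)
    also have "\<dots> \<le> (\<Sum>i<Q. r * (a i / D))"
      using g0(2) by (intro sum_mono) auto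
    also have "\<dots> = r * ((\<Sum>i<Q. real (a i)) / D)"
      by (simp add: sum_distrib_left sum_divide_distrib)
    also have "\<dots> \<le> r * ((D + Q) / D)"
      using suma r D by (intro mult_left_mono divide_right_mono) auto
    also have "(D + Q) / D = 1 + 1 / A"
      using Q A by (simp add: D_def field_simps)
    finally show ?thesis using aS gG by blast
  qed
  ultimately show ?thesis
    unfolding l1_cover_def by blast
qed

text \<open>The \<open>M\<close> coordinates are embedded in \<open>k\<close> large blocks of length
  \<open>p * n\<close>. One is dropped, and the other \<open>l = k - 1\<close> split into
  \<open>Q = l * p\<close> blocks of length \<open>n\<close>, covered with rounding parameter
  \<open>k\<close>. The \<open>p * n\<close> dropped coordinates pay for the rounding because
  \<open>n \<ge> k * (k + 2)\<close>.\<close>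

lemma l1_cover_eventually:
  fixes n k :: nat
  assumes k: "k \<ge> 2" and n: "n \<ge> k * (k + 2)" and r: "r > 0"
    and cov: "l1_cover {..<n} (2 ^ n) r"
  shows "\<forall>\<^sub>F M in sequentially. l1_cover {..<M} (2 ^ M) (r * (1 + 1 / k) + 1 / k)"
proof (rule eventually_sequentiallyI)
  fix M assume M: "M \<ge> k * n * n"
  obtain l where l: "k = Suc l" "l > 0"
    using k by (cases k) auto
  \<comment> \<open>The quotient plus one makes \<open>k * p * n\<close> at least \<open>M\<close>,
    exceeding it by at most \<open>k * n\<close>.\<close>
  define p where "p = M div (k * n) + 1"
  have n0: "n > 0" using n k by (cases n) auto
  have kn: "k * n > 0" using k n0 by simp
  have pn: "p \<ge> n + 1"
    using M kn by (simp add: p_def less_eq_div_iff_mult_less_eq algebra_simps)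
  have M_le: "M \<le> k * (p * n)"
  proof -
    have "M < (M div (k * n) + 1) * (k * n)"
      using dividend_less_div_times[of "k * n" M] kn by simp
    then show ?thesis by (simp add: p_def algebra_simps)
  qed
  have M_ge: "k * (p * n) \<le> M + k * n"
    using div_times_less_eq_dividend[of M "k * n"] by (simp add: p_def algebra_simps)
  define Q where "Q = l * p"
  have "l1_cover ({..<Q} \<times> {..<n}) (2 ^ ((k + 2) * Q) * (2 ^ n) ^ Q) (r * (1 + 1 / k))"
    using k l pn by (intro l1_cover_product[OF cov r]) (auto simp: Q_def)
  then have "l1_cover ({..<l} \<times> {..<p * n}) (2 ^ ((k + 2) * Q) * (2 ^ n) ^ Q) (r * (1 + 1 / k))"
    by (rule l1_cover_reindex[rotated 3]) (auto simp: Q_def)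
  then have "l1_cover ({..<k} \<times> {..<p * n}) (k * (2 ^ ((k + 2) * Q) * (2 ^ n) ^ Q))
      (r * (1 + 1 / k) + 1 / k)"
    unfolding l(1) by (intro l1_cover_drop_block) auto
  then have "l1_cover {..<M} (k * (2 ^ ((k + 2) * Q) * (2 ^ n) ^ Q)) (r * (1 + 1 / k) + 1 / k)"
    by (rule l1_cover_reindex[rotated 3]) (use M_le in auto)
  moreover have "k * (2 ^ ((k + 2) * Q) * (2 ^ n) ^ Q) \<le> (2::nat) ^ M"
  proof -
    \<comment> \<open>The summand \<open>k\<close> stands for the factor
      \<open>k \<le> 2 ^ k\<close>. After \<open>(k + 2) * Q\<close> is paid out of
      \<open>p * n\<close>, at least \<open>(k + 2) * p\<close> remains; as
      \<open>p \<ge> n + 1\<close>, this absorbs \<open>k\<close> and the overshoot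
      \<open>k * n\<close>.\<close>
    have "k + (k + 2) * Q + n * Q \<le> M"
    proof -
      have 1: "k * (k + 2) * p \<le> p * n" using n by simp
      have 2: "(k + 2) * (n + 1) \<le> (k + 2) * p" by (rule mult_le_mono[OF order_refl pn])
      have 3: "k * (p * n) = l * (p * n) + p * n" by (simp add: l)
      have 4: "n * Q = l * (p * n)" by (simp add: Q_def)
      have 5: "k * (k + 2) * p = (k + 2) * Q + (k + 2) * p" by (simp add: Q_def l algebra_simps)
      have 6: "(k + 2) * (n + 1) = k * n + k + 2 * n + 2" by (simp add: algebra_simps)
      from 1 2 3 4 5 6 M_ge show ?thesis by linarith
    qed
    then have "(2::nat) ^ (k + (k + 2) * Q + n * Q) \<le> 2 ^ M"
      by (intro power_increasing) auto
    moreover have "k \<le> 2 ^ k"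
      using less_exp[of k] by simp
    moreover have "k * (2 ^ ((k + 2) * Q) * (2 ^ n) ^ Q) = k * (2::nat) ^ ((k + 2) * Q + n * Q)"
      by (simp only: power_add power_mult[symmetric])
    moreover have "k * (2::nat) ^ ((k + 2) * Q + n * Q) \<le> 2 ^ k * 2 ^ ((k + 2) * Q + n * Q)"
      using \<open>k \<le> 2 ^ k\<close> by (rule mult_le_mono1)
    moreover have "(2::nat) ^ k * 2 ^ ((k + 2) * Q + n * Q) = 2 ^ (k + (k + 2) * Q + n * Q)"
      by (simp only: power_add mult.assoc)
    ultimately show ?thesis by linarith
  qed
  ultimately show "l1_cover {..<M} (2 ^ M) (r * (1 + 1 / k) + 1 / k)"
    by (rule l1_cover_mono) simp
qed

section \<open>Attainment of the minimum\<close>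

text \<open>Bolzano-Weierstrass, one coordinate at a time: a further subsequence makes the new
  coordinate monotone and preserves the limits already obtained.\<close>

lemma common_convergent_subseq:
  fixes f :: "nat \<Rightarrow> 'j \<Rightarrow> real"
  assumes "finite J" "\<And>k j. \<bar>f k j\<bar> \<le> b"
  shows "\<exists>h. strict_mono (h :: nat \<Rightarrow> nat) \<and> (\<forall>j\<in>J. convergent (\<lambda>k. f (h k) j))"
  using assms(1)
proof (induction J rule: finite_induct)
  case empty
  show ?case by (intro exI[of _ "\<lambda>k. k"]) (simp add: strict_mono_def)
next
  case (insert j J)
  then obtain h where h: "strict_mono (h :: nat \<Rightarrow> nat)" "\<And>i. i \<in> J \<Longrightarrow> convergent (\<lambda>k. f (h k) i)"
    by blast
  obtain h' where h': "strict_mono h'" "monoseq (\<lambda>k. f (h (h' k)) j)"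
    using seq_monosub[of "\<lambda>k. f (h k) j"] by blast
  have "Bseq (\<lambda>k. f (h (h' k)) j)"
    using assms(2) by (intro BseqI'[of _ b]) simp
  then have "convergent (\<lambda>k. f (h (h' k)) j)"
    using h'(2) by (rule Bseq_monoseq_convergent)
  moreover have "convergent (\<lambda>k. f (h (h' k)) i)" if "i \<in> J" for i
    using convergent_subseq_convergent[OF h(2)[OF that] h'(1)] by (simp add: o_def)
  ultimately show ?case
    using strict_mono_o[OF h(1) h'(1)]
    by (intro exI[of _ "\<lambda>k. h (h' k)"]) (auto simp: o_def)
qed

text \<open>Clipping the coordinates of the centers to \<open>[-1, 1]\<close> brings them closer to every point of the
  ball; this makes the centers range over a compact set.\<close>

lemma l1_cover_bounded_centers:
  assumes fin: "finite I" and cov: "l1_cover I m r"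
  obtains v :: "nat \<Rightarrow> 'i \<Rightarrow> real" where "\<And>k i. \<bar>v k i\<bar> \<le> 1"
    "\<And>x. (\<Sum>i\<in>I. \<bar>x i\<bar>) \<le> 1 \<Longrightarrow> \<exists>k<m. (\<Sum>i\<in>I. \<bar>x i - v k i\<bar>) \<le> r"
proof -
  obtain U where U: "finite U" "card U \<le> m"
    "\<And>x. (\<Sum>i\<in>I. \<bar>x i\<bar>) \<le> 1 \<Longrightarrow> \<exists>u\<in>U. (\<Sum>i\<in>I. \<bar>x i - u i\<bar>) \<le> r"
    using cov unfolding l1_cover_def by blast
  \<comment> \<open>Indices from \<open>card U\<close> on yield arbitrary vectors, which are clipped
    as well and only enlarge the cover.\<close>
  obtain e where e: "U = e ` {..<card U}"
    using ex_bij_betw_nat_finite[OF U(1)] by (metis atLeast0LessThan bij_betw_imp_surj_on)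
  define v where "v k i = max (-1) (min 1 (e k i))" for k i
  show thesis
  proof (rule that[of v])
    show "\<bar>v k i\<bar> \<le> 1" for k i
      by (auto simp: v_def)
    fix x :: "'i \<Rightarrow> real" assume x: "(\<Sum>i\<in>I. \<bar>x i\<bar>) \<le> 1"
    obtain k where k: "k < m" "(\<Sum>i\<in>I. \<bar>x i - e k i\<bar>) \<le> r"
    proof -
      obtain u where "u \<in> U" "(\<Sum>i\<in>I. \<bar>x i - u i\<bar>) \<le> r" using U(3)[OF x] by blast
      moreover from this obtain k where "k < card U" "u = e k" using e by blast
      ultimately show thesis using that[of k] U(2) by simp
    qed
    have "(\<Sum>i\<in>I. \<bar>x i - v k i\<bar>) \<le> (\<Sum>i\<in>I. \<bar>x i - e k i\<bar>)"
    proof (rule sum_mono)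
      fix i assume "i \<in> I"
      then have "\<bar>x i\<bar> \<le> 1"
        using member_le_sum[of i I "\<lambda>i. \<bar>x i\<bar>"] fin x by auto
      then show "\<bar>x i - v k i\<bar> \<le> \<bar>x i - e k i\<bar>"
        by (auto simp: v_def)
    qed
    with k show "\<exists>k<m. (\<Sum>i\<in>I. \<bar>x i - v k i\<bar>) \<le> r"
      by force
  qed
qed

text \<open>Compactness: along a subsequence all \<open>m\<close> bounded centers converge on
  \<open>I\<close>. A point missed by every limit center would be missed by some cover of the
  sequence, since finitely many strict inequalities persist under small perturbation.\<close>

lemma l1_cover_limit:
  assumes fin: "finite I" and cov: "\<And>k. l1_cover I m (r k)" and lim: "r \<longlonglongrightarrow> s"
  shows "l1_cover I m s"
proof -
  have "\<exists>v. (\<forall>a i. \<bar>v a i\<bar> \<le> 1) \<and>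
      (\<forall>x. (\<Sum>i\<in>I. \<bar>x i\<bar>) \<le> 1 \<longrightarrow> (\<exists>a<m. (\<Sum>i\<in>I. \<bar>x i - v a i\<bar>) \<le> r k))" for k
    using l1_cover_bounded_centers[OF fin cov[of k]] by metis
  then obtain v :: "nat \<Rightarrow> nat \<Rightarrow> 'a \<Rightarrow> real" where v: "\<And>k a i. \<bar>v k a i\<bar> \<le> 1"
    "\<And>k x. (\<Sum>i\<in>I. \<bar>x i\<bar>) \<le> 1 \<Longrightarrow> \<exists>a<m. (\<Sum>i\<in>I. \<bar>x i - v k a i\<bar>) \<le> r k"
    by metis
  obtain h where h: "strict_mono (h :: nat \<Rightarrow> nat)"
    "\<And>a i. a < m \<Longrightarrow> i \<in> I \<Longrightarrow> convergent (\<lambda>k. v (h k) a i)"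
    using common_convergent_subseq[of "{..<m} \<times> I" "\<lambda>k (a, i). v k a i" 1] fin v(1)
    by (auto simp: case_prod_unfold)
  define u where "u a i = lim (\<lambda>k. v (h k) a i)" for a i
  have u: "(\<lambda>k. v (h k) a i) \<longlonglongrightarrow> u a i" if "a < m" "i \<in> I" for a i
    using h(2)[OF that] by (simp add: u_def convergent_LIMSEQ_iff)
  have "\<exists>a<m. (\<Sum>i\<in>I. \<bar>x i - u a i\<bar>) \<le> s" if x: "(\<Sum>i\<in>I. \<bar>x i\<bar>) \<le> 1" for x
  proof (rule ccontr)
    assume "\<not> ?thesis"
    then have less: "s < (\<Sum>i\<in>I. \<bar>x i - u a i\<bar>)" if "a < m" for a
      using that by force
    have rh: "(\<lambda>k. r (h k)) \<longlonglongrightarrow> s"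
      using LIMSEQ_subseq_LIMSEQ[OF lim h(1)] by (simp add: o_def)
    have "\<forall>\<^sub>F k in sequentially. r (h k) < (\<Sum>i\<in>I. \<bar>x i - v (h k) a i\<bar>)" if "a < m" for a
    proof -
      have "(\<lambda>k. (\<Sum>i\<in>I. \<bar>x i - v (h k) a i\<bar>) - r (h k)) \<longlonglongrightarrow> (\<Sum>i\<in>I. \<bar>x i - u a i\<bar>) - s"
        using that by (intro tendsto_intros u rh)
      from order_tendstoD(1)[OF this, of 0] less[OF that] show ?thesis by simp
    qed
    then have ev: "\<forall>\<^sub>F k in sequentially. \<forall>a\<in>{..<m}. r (h k) < (\<Sum>i\<in>I. \<bar>x i - v (h k) a i\<bar>)"
      by (intro eventually_ball_finite) auto
    then obtain k where "\<forall>a<m. r (h k) < (\<Sum>i\<in>I. \<bar>x i - v (h k) a i\<bar>)"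
      using eventually_happens'[OF sequentially_bot ev] by blast
    with v(2)[OF x, of "h k"] show False by force
  qed
  moreover have "card (u ` {..<m}) \<le> m"
    using card_image_le[of "{..<m}" u] by simp
  ultimately show ?thesis
    unfolding l1_cover_def by (intro exI[of _ "u ` {..<m}"]) auto
qed

text \<open>With radius zero, the finitely many centers would have to take every value in
  \<open>[0, 1]\<close> at coordinate \<open>i\<close>. This keeps the infimum of admissible radii
  positive.\<close>

lemma not_l1_cover_0:
  fixes I :: "'i set"
  assumes fin: "finite I" and i: "i \<in> I"
  shows "\<not> l1_cover I m 0"
proof
  assume "l1_cover I m 0"
  then obtain U :: "('i \<Rightarrow> real) set" where U: "finite U"
    "\<And>x. (\<Sum>i\<in>I. \<bar>x i\<bar>) \<le> 1 \<Longrightarrow> \<exists>u\<in>U. (\<Sum>i\<in>I. \<bar>x i - u i\<bar>) \<le> 0"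
    unfolding l1_cover_def by blast
  have "{0..1} \<subseteq> (\<lambda>u. u i) ` U"
  proof
    fix t :: real assume t: "t \<in> {0..1}"
    let ?x = "\<lambda>j. if j = i then t else 0"
    have "(\<Sum>j\<in>I. \<bar>?x j\<bar>) = (\<Sum>j\<in>I. if j = i then t else 0)"
      using t by (intro sum.cong) auto
    also have "\<dots> = t"
      using fin i by simp
    finally obtain u where u: "u \<in> U" "(\<Sum>j\<in>I. \<bar>?x j - u j\<bar>) \<le> 0"
      using U(2)[of ?x] t by auto
    have "\<bar>?x i - u i\<bar> \<le> (\<Sum>j\<in>I. \<bar>?x j - u j\<bar>)"
      using fin i by (intro member_le_sum) auto
    then have "u i = t" using u(2) by simp
    with u(1) show "t \<in> (\<lambda>u. u i) ` U" by blast
  qed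
  then have "finite {0..1::real}"
    using U(1) by (rule finite_subset[OF _ finite_imageI])
  then show False
    using infinite_Icc[of 0 "1::real"] by simp
qed

text \<open>The infimum of the admissible radii is itself admissible, by passing to the limit, and
  is not zero; hence it is the least element and \<open>LEAST\<close> is meaningful.\<close>

lemma Least_l1_cover:
  assumes fin: "finite I" and ne: "I \<noteq> {}" and m: "m \<ge> 1"
  defines "g \<equiv> LEAST r. 0 < r \<and> l1_cover I m r"
  shows "0 < g" and "l1_cover I m g" and "\<And>r. 0 < r \<Longrightarrow> l1_cover I m r \<Longrightarrow> g \<le> r"
proof -
  define S where "S = {r. 0 < r \<and> l1_cover I m r}"
  have S1: "1 \<in> S" using l1_cover_one[OF m] by (simp add: S_def)
  have bdd: "bdd_below S" by (intro bdd_belowI[of _ 0]) (auto simp: S_def)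
  have "\<exists>r\<in>S. r < Inf S + 1 / Suc k" for k
    using S1 bdd by (subst cInf_less_iff[symmetric]) auto
  then obtain r where r: "\<And>k. r k \<in> S" "\<And>k. r k < Inf S + 1 / Suc k" by metis
  have "r \<longlonglongrightarrow> Inf S"
  proof (rule tendsto_sandwich)
    show "\<forall>\<^sub>F k in sequentially. Inf S \<le> r k"
      using r(1) bdd by (auto intro!: always_eventually cInf_lower)
    show "\<forall>\<^sub>F k in sequentially. r k \<le> Inf S + 1 / Suc k"
      using r(2) by (auto intro!: always_eventually less_imp_le)
    show "(\<lambda>k. Inf S + 1 / Suc k) \<longlonglongrightarrow> Inf S"
      using tendsto_add[OF tendsto_const LIMSEQ_inverse_real_of_nat, of "Inf S"]
      by (simp add: inverse_eq_divide)
  qed simp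
  moreover have "l1_cover I m (r k)" for k
    using r(1)[of k] by (simp add: S_def)
  ultimately have cov: "l1_cover I m (Inf S)"
    by (rule l1_cover_limit[OF fin, rotated])
  have "Inf S \<ge> 0"
  proof (rule cInf_greatest)
    show "S \<noteq> {}" using S1 by blast
    show "0 \<le> r" if "r \<in> S" for r using that by (simp add: S_def)
  qed
  moreover have "Inf S \<noteq> 0" using cov not_l1_cover_0[OF fin] ne by auto
  ultimately have pos: "Inf S > 0" by simp
  have low: "Inf S \<le> r" if "0 < r" "l1_cover I m r" for r
    using that bdd by (intro cInf_lower) (auto simp: S_def)
  have "g = Inf S"
    unfolding g_def by (rule Least_equality) (use pos cov low in blast)+
  then show "0 < g" "l1_cover I m g"
    using pos cov by simp_all
  show "g \<le> r" if "0 < r" "l1_cover I m r" for r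
    using low[OF that] \<open>g = Inf S\<close> by simp
qed

section \<open>From translates of the cross-polytope to \<open>l1_cover\<close>\<close>

text \<open>For \<open>r > 0\<close>, a point lies in the translate by \<open>u\<close> of the
  scaled cross-polytope exactly when its l1-distance from \<open>u\<close> is at most
  \<open>r\<close>.\<close>

lemma translates_cover_iff_l1_cover:
  assumes r: "0 < r" and m: "m \<ge> 1"
  shows "(\<exists>u. (\<forall>i\<in>{1..m}. u i \<in> carrier_vec n) \<and>
      cross_polytope n \<subseteq> (\<Union>i\<in>{1..m}. (\<lambda>x. r \<cdot>\<^sub>v x + u i) ` cross_polytope n))
    \<longleftrightarrow> l1_cover {..<n} m r"
proof -
  have mem: "x \<in> (\<lambda>x. r \<cdot>\<^sub>v x + u) ` cross_polytope n \<longleftrightarrow> (\<Sum>i<n. \<bar>x $ i - u $ i\<bar>) \<le> r"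
    if x: "x \<in> carrier_vec n" and u: "u \<in> carrier_vec n" for x u
  proof
    assume "x \<in> (\<lambda>x. r \<cdot>\<^sub>v x + u) ` cross_polytope n"
    then obtain y where y: "y \<in> carrier_vec n" "(\<Sum>i<n. \<bar>y $ i\<bar>) \<le> 1" "x = r \<cdot>\<^sub>v y + u"
      by (auto simp: cross_polytope_def)
    have "(\<Sum>i<n. \<bar>x $ i - u $ i\<bar>) = (\<Sum>i<n. r * \<bar>y $ i\<bar>)"
      using y u r by (intro sum.cong) (auto simp: abs_mult)
    also have "\<dots> = r * (\<Sum>i<n. \<bar>y $ i\<bar>)"
      by (simp add: sum_distrib_left)
    also have "\<dots> \<le> r" using y(2) r by simp
    finally show "(\<Sum>i<n. \<bar>x $ i - u $ i\<bar>) \<le> r" .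
  next
    assume le: "(\<Sum>i<n. \<bar>x $ i - u $ i\<bar>) \<le> r"
    define y where "y = (1 / r) \<cdot>\<^sub>v (x - u)"
    have y: "y \<in> carrier_vec n" using x u by (simp add: y_def)
    have "(\<Sum>i<n. \<bar>y $ i\<bar>) = (\<Sum>i<n. \<bar>x $ i - u $ i\<bar> / r)"
      using x u r by (intro sum.cong) (auto simp: y_def)
    also have "\<dots> \<le> 1"
      using le r by (simp add: sum_divide_distrib[symmetric])
    finally have "y \<in> cross_polytope n"
      using y by (simp add: cross_polytope_def)
    moreover have "x = r \<cdot>\<^sub>v y + u"
      using x u r by (intro eq_vecI) (auto simp: y_def)
    ultimately show "x \<in> (\<lambda>x. r \<cdot>\<^sub>v x + u) ` cross_polytope n" by blast
  qed
  show ?thesis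
  proof
    assume "\<exists>u. (\<forall>i\<in>{1..m}. u i \<in> carrier_vec n) \<and>
      cross_polytope n \<subseteq> (\<Union>i\<in>{1..m}. (\<lambda>x. r \<cdot>\<^sub>v x + u i) ` cross_polytope n)"
    then obtain u where u: "\<And>k. k \<in> {1..m} \<Longrightarrow> u k \<in> carrier_vec n"
      "cross_polytope n \<subseteq> (\<Union>k\<in>{1..m}. (\<lambda>x. r \<cdot>\<^sub>v x + u k) ` cross_polytope n)"
      by blast
    define U where "U = (\<lambda>k i. u k $ i) ` {1..m}"
    have "\<exists>w\<in>U. (\<Sum>i<n. \<bar>x i - w i\<bar>) \<le> r" if x: "(\<Sum>i<n. \<bar>x i\<bar>) \<le> 1" for x
    proof -
      have "vec n x \<in> cross_polytope n"
        using x by (simp add: cross_polytope_def)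
      then obtain k where k: "k \<in> {1..m}" "vec n x \<in> (\<lambda>x. r \<cdot>\<^sub>v x + u k) ` cross_polytope n"
        using u(2) by blast
      then have "(\<Sum>i<n. \<bar>vec n x $ i - u k $ i\<bar>) \<le> r"
        using mem u(1) vec_carrier by blast
      with k(1) show ?thesis by (auto simp: U_def)
    qed
    moreover have "card U \<le> m"
      using card_image_le[of "{1..m}" "\<lambda>k i. u k $ i"] by (simp add: U_def)
    ultimately show "l1_cover {..<n} m r"
      unfolding l1_cover_def by (intro exI[of _ U]) (auto simp: U_def)
  next
    assume "l1_cover {..<n} m r"
    then obtain v where v: "\<And>x. (\<Sum>i<n. \<bar>x i\<bar>) \<le> 1 \<Longrightarrow> \<exists>k<m. (\<Sum>i<n. \<bar>x i - v k i\<bar>) \<le> r"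
      using l1_cover_bounded_centers[OF finite_lessThan] by metis
    \<comment> \<open>The centers \<open>v\<close> are numbered from 0, the translates from
      1.\<close>
    define u where "u k = vec n (v (k - 1))" for k
    have "x \<in> (\<Union>k\<in>{1..m}. (\<lambda>x. r \<cdot>\<^sub>v x + u k) ` cross_polytope n)"
      if x: "x \<in> cross_polytope n" for x
    proof -
      have xc: "x \<in> carrier_vec n" "(\<Sum>i<n. \<bar>x $ i\<bar>) \<le> 1"
        using x by (auto simp: cross_polytope_def)
      obtain k where k: "k < m" "(\<Sum>i<n. \<bar>x $ i - v k i\<bar>) \<le> r"
        using v[OF xc(2)] by blast
      have "x \<in> (\<lambda>x. r \<cdot>\<^sub>v x + u (Suc k)) ` cross_polytope n"
        using k(2) by (subst mem[OF xc(1)]) (auto simp: u_def)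
      with k(1) show ?thesis by (intro UN_I[of "Suc k"]) auto
    qed
    then show "\<exists>u. (\<forall>i\<in>{1..m}. u i \<in> carrier_vec n) \<and>
      cross_polytope n \<subseteq> (\<Union>i\<in>{1..m}. (\<lambda>x. r \<cdot>\<^sub>v x + u i) ` cross_polytope n)"
      by (intro exI[of _ u]) (auto simp: u_def)
  qed
qed

lemma hadwiger_gamma_cross_polytope:
  assumes "m \<ge> 1"
  shows "hadwiger_gamma n m (cross_polytope n) = (LEAST r. 0 < r \<and> l1_cover {..<n} m r)"
proof -
  have "(\<lambda>r. 0 < r \<and>
      (\<exists>u. (\<forall>i\<in>{1..m}. u i \<in> carrier_vec n) \<and>
        cross_polytope n \<subseteq> (\<Union>i\<in>{1..m}. (\<lambda>x. r \<cdot>\<^sub>v x + u i) ` cross_polytope n)))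
    = (\<lambda>r. 0 < r \<and> l1_cover {..<n} m r)"
    by (rule ext, rule conj_cong[OF refl], rule translates_cover_iff_l1_cover, assumption, rule assms)
  then show ?thesis
    unfolding hadwiger_gamma_def by (rule arg_cong)
qed

section \<open>The constants\<close>

text \<open>This and \<open>c4_log\<close> are the logarithms of the left-hand sides of the
  equations in \<open>is_c3\<close> and \<open>is_c4\<close>, so that roots become zeros.\<close>

definition c3_log :: "real \<Rightarrow> real" where
  "c3_log c = (1 + c) * ln (1 + c) - c * ln c - (1 - c) * ln 2"

definition c4_log :: "real \<Rightarrow> real" where
  "c4_log c = - c * ln c - (1 - c) * ln (1 - c) - (1 - c) * ln 2"

lemma is_c3_iff: "is_c3 c \<longleftrightarrow> 0 < c \<and> c3_log c = 0"
proof (cases "0 < c")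
  case True
  then have "1 / 2 powr (1 - c) * ((1 + c) powr (1 + c) / c powr c) = exp (c3_log c)"
    by (simp add: c3_log_def powr_def exp_diff)
  then show ?thesis by (simp add: is_c3_def)
qed (simp add: is_c3_def)

lemma is_c4_iff: "is_c4 c \<longleftrightarrow> 0 < c \<and> c < 1 \<and> c4_log c = 0"
proof (cases "0 < c \<and> c < 1")
  case True
  then have "1 / 2 powr (1 - c) * (1 / (c powr c * (1 - c) powr (1 - c))) = exp (c4_log c)"
    by (simp add: c4_log_def powr_def exp_diff exp_minus inverse_eq_divide)
  then show ?thesis by (simp add: is_c4_def)
qed (auto simp: is_c4_def)

lemma c3_log_DERIV:
  assumes "0 < c"
  shows "DERIV c3_log c :> ln (1 + c) - ln c + ln 2"
  unfolding c3_log_def using assms by (auto intro!: derivative_eq_intros)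

lemma c4_log_DERIV:
  assumes "0 < c" "c < 1"
  shows "DERIV c4_log c :> ln (1 - c) - ln c + ln 2"
  unfolding c4_log_def using assms by (auto intro!: derivative_eq_intros)

lemma c3_log_strict_mono:
  assumes "0 < a" "a < b"
  shows "c3_log a < c3_log b"
proof (rule DERIV_pos_imp_increasing[OF assms(2)])
  fix c assume "a \<le> c"
  then have c: "0 < c" using assms by simp
  then have "ln c < ln (1 + c)" by simp
  moreover have "ln (2::real) > 0" by simp
  ultimately have "0 < ln (1 + c) - ln c + ln 2" by linarith
  with c3_log_DERIV[OF c] show "\<exists>y. DERIV c3_log c :> y \<and> y > 0" by blast
qed

text \<open>The derivative is the logarithm of \<open>2 * (1 - c) / c\<close>, positive for
  \<open>c < 2 / 3\<close>; the range up to 1/2 is complemented by a direct sign estimate beyond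
  it.\<close>

lemma c4_log_strict_mono:
  assumes "0 < a" "a < b" "b \<le> 1 / 2"
  shows "c4_log a < c4_log b"
proof (rule DERIV_pos_imp_increasing[OF assms(2)])
  fix c assume "a \<le> c" "c \<le> b"
  then have c: "0 < c" "c < 1" "c \<le> 1 / 2" using assms by auto
  then have "ln c \<le> ln (1 - c)" by simp
  moreover have "ln (2::real) > 0" by simp
  ultimately have "0 < ln (1 - c) - ln c + ln 2" by linarith
  with c4_log_DERIV[OF c(1,2)] show "\<exists>y. DERIV c4_log c :> y \<and> y > 0" by blast
qed

text \<open>Monotonicity fails near 1, where \<open>c4_log\<close> decreases to 0. Absorbing
  \<open>ln 2\<close> into \<open>ln (1 - c)\<close> instead leaves two terms of evident
  sign.\<close>

lemma c4_log_pos: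
  assumes "1 / 2 \<le> c" "c < 1"
  shows "0 < c4_log c"
proof -
  have "ln (2 * (1 - c)) \<le> 0" using assms by simp
  then have "(1 - c) * ln (2 * (1 - c)) \<le> 0" using assms by (simp add: mult_nonneg_nonpos)
  moreover have "c * ln c < 0" using assms by (simp add: mult_pos_neg)
  moreover have "ln (2 * (1 - c)) = ln 2 + ln (1 - c)"
    using assms by (intro ln_mult_pos) auto
  then have "c4_log c = - (c * ln c) - (1 - c) * ln (2 * (1 - c))"
    by (simp only: c4_log_def) (simp add: algebra_simps)
  ultimately show ?thesis by linarith
qed

text \<open>At a rational \<open>p / q\<close> the signs of the two functions are decided by comparing integers.  The
  fractions \<open>37/180\<close>, \<open>22/107\<close> and \<open>47/207\<close>, \<open>62/273\<close> below have the smallest denominators among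
  those lying between the roots and the required error bounds.\<close>

lemma c3_log_fraction:
  fixes p q s t :: nat
  assumes "0 < p" "q = p + s" "t = p + q"
  shows "real q * c3_log (p / q) = ln (real (t ^ t)) - ln (real (2 ^ s * p ^ p * q ^ q))"
proof -
  define X Y Z w where "X = ln (real t)" and "Y = ln (real p)" and "Z = ln (real q)"
    and "w = real p / real q"
  have p: "real p = real q * w" using assms by (simp add: w_def)
  have "1 + w = real t / q" using assms by (simp add: w_def field_simps)
  then have "ln (1 + w) = X - Z"
    unfolding X_def Z_def using assms by (simp only:) (intro ln_divide_pos, auto)
  moreover have "ln w = Y - Z"
    unfolding w_def Y_def Z_def using assms by (intro ln_divide_pos) auto
  ultimately have "real q * c3_log w
      = (real q + real q * w) * (X - Z) - real q * w * (Y - Z) - (real q - real q * w) * ln 2"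
    by (simp only: c3_log_def) (simp add: algebra_simps)
  then have "real q * c3_log w = t * (X - Z) - p * (Y - Z) - s * ln 2"
    unfolding p[symmetric] using assms by simp
  moreover have "ln (real (t ^ t)) = t * X"
    using assms by (simp add: X_def ln_realpow)
  moreover have "ln (real (2 ^ s * p ^ p * q ^ q)) = s * ln 2 + p * Y + q * Z"
    using assms by (simp add: Y_def Z_def ln_mult ln_realpow)
  ultimately show ?thesis using assms by (simp add: w_def algebra_simps)
qed

lemma c4_log_fraction:
  fixes p q s :: nat
  assumes "0 < p" "0 < s" "q = p + s"
  shows "real q * c4_log (p / q) = ln (real (q ^ q)) - ln (real (2 ^ s * p ^ p * s ^ s))"
proof -
  define X Y Z w where "X = ln (real s)" and "Y = ln (real p)" and "Z = ln (real q)"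
    and "w = real p / real q"
  have p: "real p = real q * w" using assms by (simp add: w_def)
  have "1 - w = real s / q" using assms by (simp add: w_def field_simps)
  then have "ln (1 - w) = X - Z"
    unfolding X_def Z_def using assms by (simp only:) (intro ln_divide_pos, auto)
  moreover have "ln w = Y - Z"
    unfolding w_def Y_def Z_def using assms by (intro ln_divide_pos) auto
  ultimately have "real q * c4_log w
      = - (real q * w) * (Y - Z) - (real q - real q * w) * (X - Z) - (real q - real q * w) * ln 2"
    by (simp only: c4_log_def) (simp add: algebra_simps)
  then have "real q * c4_log w = - p * (Y - Z) - s * (X - Z) - s * ln 2"
    unfolding p[symmetric] using assms by simp
  moreover have "ln (real (q ^ q)) = q * Z"
    using assms by (simp add: Z_def ln_realpow)
  moreover have "ln (real (2 ^ s * p ^ p * s ^ s)) = s * ln 2 + p * Y + s * X"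
    using assms by (simp add: X_def Y_def ln_mult ln_realpow)
  ultimately show ?thesis using assms by (simp add: w_def algebra_simps)
qed

lemma c3_log_fraction_neg:
  fixes p q s t :: nat
  assumes "0 < p" "q = p + s" "t = p + q" and less: "t ^ t < 2 ^ s * p ^ p * q ^ q"
  shows "c3_log (p / q) < 0"
proof -
  have "real (t ^ t) < real (2 ^ s * p ^ p * q ^ q)"
    using less by (simp only: of_nat_less_iff)
  then have "ln (real (t ^ t)) < ln (real (2 ^ s * p ^ p * q ^ q))"
    using assms by (subst ln_less_cancel_iff) auto
  then have "real q * c3_log (p / q) < 0"
    unfolding c3_log_fraction[OF assms(1-3)] by simp
  then show ?thesis by (simp add: mult_less_0_iff)
qed

lemma c3_log_fraction_pos:
  fixes p q s t :: nat
  assumes "0 < p" "q = p + s" "t = p + q" and less: "t ^ t > 2 ^ s * p ^ p * q ^ q"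
  shows "c3_log (p / q) > 0"
proof -
  have "real (t ^ t) > real (2 ^ s * p ^ p * q ^ q)"
    using less by (simp only: of_nat_less_iff)
  then have "ln (real (t ^ t)) > ln (real (2 ^ s * p ^ p * q ^ q))"
    using assms by (subst ln_less_cancel_iff) auto
  then have "real q * c3_log (p / q) > 0"
    unfolding c3_log_fraction[OF assms(1-3)] by simp
  then show ?thesis by (simp add: zero_less_mult_iff)
qed

lemma c4_log_fraction_neg:
  fixes p q s :: nat
  assumes "0 < p" "0 < s" "q = p + s" and less: "q ^ q < 2 ^ s * p ^ p * s ^ s"
  shows "c4_log (p / q) < 0"
proof -
  have "real (q ^ q) < real (2 ^ s * p ^ p * s ^ s)"
    using less by (simp only: of_nat_less_iff)
  then have "ln (real (q ^ q)) < ln (real (2 ^ s * p ^ p * s ^ s))"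
    using assms by (subst ln_less_cancel_iff) auto
  then have "real q * c4_log (p / q) < 0"
    unfolding c4_log_fraction[OF assms(1-3)] by simp
  then show ?thesis by (simp add: mult_less_0_iff)
qed

lemma c4_log_fraction_pos:
  fixes p q s :: nat
  assumes "0 < p" "0 < s" "q = p + s" and less: "q ^ q > 2 ^ s * p ^ p * s ^ s"
  shows "c4_log (p / q) > 0"
proof -
  have "real (q ^ q) > real (2 ^ s * p ^ p * s ^ s)"
    using less by (simp only: of_nat_less_iff)
  then have "ln (real (q ^ q)) > ln (real (2 ^ s * p ^ p * s ^ s))"
    using assms by (subst ln_less_cancel_iff) auto
  then have "real q * c4_log (p / q) > 0"
    unfolding c4_log_fraction[OF assms(1-3)] by simp
  then show ?thesis by (simp add: zero_less_mult_iff)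
qed

section \<open>Numerical brackets and uniqueness of the two roots\<close>

lemma c3_log_lower: "c3_log (37 / 180) < 0"
proof -
  have "(217::nat) ^ 217 < 2 ^ 143 * 37 ^ 37 * 180 ^ 180"
    by (simp only: power_numeral pow.simps sqr.simps arith_simps rel_simps simp_thms)
  then have "c3_log (real 37 / real 180) < 0"
    by (rule c3_log_fraction_neg[where p = 37 and q = 180 and s = 143 and t = 217, rotated 3]) simp_all
  then show ?thesis by (simp only: of_nat_numeral)
qed

lemma c3_log_upper: "c3_log (22 / 107) > 0"
proof -
  have "(129::nat) ^ 129 > 2 ^ 85 * 22 ^ 22 * 107 ^ 107"
    by (simp only: power_numeral pow.simps sqr.simps arith_simps rel_simps simp_thms)
  then have "c3_log (real 22 / real 107) > 0"
    by (rule c3_log_fraction_pos[where p = 22 and q = 107 and s = 85 and t = 129, rotated 3]) simp_all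
  then show ?thesis by (simp only: of_nat_numeral)
qed

lemma c4_log_lower: "c4_log (47 / 207) < 0"
proof -
  have "(207::nat) ^ 207 < 2 ^ 160 * 47 ^ 47 * 160 ^ 160"
    by (simp only: power_numeral pow.simps sqr.simps arith_simps rel_simps simp_thms)
  then have "c4_log (real 47 / real 207) < 0"
    by (rule c4_log_fraction_neg[where p = 47 and q = 207 and s = 160, rotated 3]) simp_all
  then show ?thesis by (simp only: of_nat_numeral)
qed

lemma c4_log_upper: "c4_log (62 / 273) > 0"
proof -
  have "(273::nat) ^ 273 > 2 ^ 211 * 62 ^ 62 * 211 ^ 211"
    by (simp only: power_numeral pow.simps sqr.simps arith_simps rel_simps simp_thms)
  then have "c4_log (real 62 / real 273) > 0"
    by (rule c4_log_fraction_pos[where p = 62 and q = 273 and s = 211, rotated 3]) simp_all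
  then show ?thesis by (simp only: of_nat_numeral)
qed

lemma c3_root:
  obtains c where "37 / 180 < c" "c < 22 / 107" "is_c3 c" "\<And>d. is_c3 d \<Longrightarrow> d = c"
proof -
  have "continuous_on {37 / 180..22 / 107} c3_log"
    by (rule DERIV_atLeastAtMost_imp_continuous_on) (use c3_log_DERIV in force)
  with c3_log_lower c3_log_upper obtain c where c: "37 / 180 \<le> c" "c \<le> 22 / 107" "c3_log c = 0"
    using IVT'[of c3_log "37 / 180" 0 "22 / 107"] by auto
  \<comment> \<open>The intermediate value theorem gives weak bounds only; the strict signs at the
    endpoints exclude equality.\<close>
  have "c3_log (37 / 180) < c3_log c" "c3_log c < c3_log (22 / 107)"
    unfolding c(3) by (fact c3_log_lower c3_log_upper)+
  then have "c \<noteq> 37 / 180" "c \<noteq> 22 / 107"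
    by (intro notI, simp only: less_irrefl)+
  then have "37 / 180 < c" "c < 22 / 107"
    using c(1,2) by simp_all
  moreover have "is_c3 c" using c by (simp add: is_c3_iff)
  moreover have "d = c" if "is_c3 d" for d
  proof -
    have "0 < d" "c3_log d = 0" "0 < c" using that c by (auto simp: is_c3_iff)
    then show ?thesis
      using c3_log_strict_mono[of c d] c3_log_strict_mono[of d c] c(3)
      by (cases c d rule: linorder_cases) auto
  qed
  ultimately show thesis by (rule that)
qed

lemma c4_root:
  obtains c where "47 / 207 < c" "c < 62 / 273" "is_c4 c" "\<And>d. is_c4 d \<Longrightarrow> d = c"
proof -
  have "continuous_on {47 / 207..62 / 273} c4_log"
    by (rule DERIV_atLeastAtMost_imp_continuous_on) (use c4_log_DERIV in force)
  with c4_log_lower c4_log_upper obtain c where c: "47 / 207 \<le> c" "c \<le> 62 / 273" "c4_log c = 0"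
    using IVT'[of c4_log "47 / 207" 0 "62 / 273"] by auto
  have "c4_log (47 / 207) < c4_log c" "c4_log c < c4_log (62 / 273)"
    unfolding c(3) by (fact c4_log_lower c4_log_upper)+
  then have "c \<noteq> 47 / 207" "c \<noteq> 62 / 273"
    by (intro notI, simp only: less_irrefl)+
  then have "47 / 207 < c" "c < 62 / 273"
    using c(1,2) by simp_all
  moreover have "is_c4 c" using c by (simp add: is_c4_iff)
  moreover have "d = c" if "is_c4 d" for d
  proof -
    have d: "0 < d" "d < 1" "c4_log d = 0" using that by (auto simp: is_c4_iff)
    \<comment> \<open>Positivity on the upper half confines every zero to the range where
      \<open>c4_log\<close> is strictly increasing.\<close>
    have "d < 1 / 2" using c4_log_pos[of d] d by force
    then show ?thesis
      using c4_log_strict_mono[of c d] c4_log_strict_mono[of d c] c d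
      by (cases c d rule: linorder_cases) auto
  qed
  ultimately show thesis by (rule that)
qed

section \<open>Coverings centered at integer vectors\<close>

text \<open>Greedy choice: the new coordinate takes as much of \<open>s\<close> as
  \<open>f i\<close> permits, and the remainder is left to the others.\<close>

lemma sum_subvector:
  fixes f :: "'i \<Rightarrow> nat"
  assumes "finite I" "s \<le> (\<Sum>i\<in>I. f i)"
  obtains g where "\<And>i. i \<in> I \<Longrightarrow> g i \<le> f i" "(\<Sum>i\<in>I. g i) = s"
proof -
  have "\<exists>g. (\<forall>i\<in>I. g i \<le> f i) \<and> (\<Sum>i\<in>I. g i) = s"
    using assms
  proof (induction I arbitrary: s rule: finite_induct)
    case (insert i I)
    have "s - min s (f i) \<le> (\<Sum>i\<in>I. f i)" using insert by auto
    then obtain g where g: "\<forall>j\<in>I. g j \<le> f j" "(\<Sum>j\<in>I. g j) = s - min s (f i)"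
      using insert.IH by blast
    have "(\<Sum>j\<in>I. (g(i := min s (f i))) j) = (\<Sum>j\<in>I. g j)"
      using insert.hyps by (intro sum.cong) auto
    then show ?case
      using g insert.hyps by (intro exI[of _ "g(i := min s (f i))"]) auto
  qed simp
  then show thesis using that by blast
qed

text \<open>The full two-sided series has sum \<open>(1 + q) / (1 - q)\<close>. It is below the
  stated bound because \<open>(1 + q) * (1 - 2 * q) \<le> 1 - q\<close>; the weaker form simplifies
  to \<open>1 + c\<close> for the weight chosen later.\<close>

lemma sum_power_nat_abs_le:
  fixes q :: real
  assumes "0 < q" "q < 1 / 2"
  shows "(\<Sum>j\<in>{- int k..int k}. q ^ nat \<bar>j\<bar>) \<le> 1 / (1 - 2 * q)"
proof -
  have eq: "(1 - q) * (\<Sum>j\<in>{- int k..int k}. q ^ nat \<bar>j\<bar>) = 1 + q - 2 * q ^ Suc k"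
  proof (induction k)
    case (Suc k)
    have "{- int (Suc k)..int (Suc k)} = insert (- int (Suc k)) (insert (int (Suc k)) {- int k..int k})"
      by auto
    then have "(\<Sum>j\<in>{- int (Suc k)..int (Suc k)}. q ^ nat \<bar>j\<bar>)
        = 2 * q ^ Suc k + (\<Sum>j\<in>{- int k..int k}. q ^ nat \<bar>j\<bar>)"
      by (simp add: nat_add_distrib)
    then have "(1 - q) * (\<Sum>j\<in>{- int (Suc k)..int (Suc k)}. q ^ nat \<bar>j\<bar>)
        = (1 - q) * (2 * q ^ Suc k) + (1 + q - 2 * q ^ Suc k)"
      by (simp only: distrib_left Suc.IH)
    then show ?case by (simp add: algebra_simps)
  qed simp
  then have "(1 - q) * (\<Sum>j\<in>{- int k..int k}. q ^ nat \<bar>j\<bar>) \<le> 1 + q"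
    using assms by simp
  then have "(\<Sum>j\<in>{- int k..int k}. q ^ nat \<bar>j\<bar>) \<le> (1 + q) / (1 - q)"
    using assms by (simp add: field_simps)
  also have "\<dots> \<le> 1 / (1 - 2 * q)"
    using assms by (simp add: divide_simps algebra_simps)
  finally show ?thesis .
qed

text \<open>The weight \<open>q = c / (2 (1 + c))\<close> makes the geometric sum at most \<open>1 + c\<close>, and then the
  defining equation of \<open>c\<^sub>3\<close> is exactly the statement that the resulting bound is \<open>2 ^ n\<close>.\<close>

lemma card_int_vectors_le:
  assumes c: "is_c3 c" and k: "real k \<le> c * n"
  shows "card {z \<in> {..<n} \<rightarrow>\<^sub>E {- int k..int k}. (\<Sum>i<n. nat \<bar>z i\<bar>) \<le> k} \<le> 2 ^ n"
proof -
  let ?N = "card {z \<in> {..<n} \<rightarrow>\<^sub>E {- int k..int k}. (\<Sum>i<n. nat \<bar>z i\<bar>) \<le> k}"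
  have c0: "c > 0" using c by (simp add: is_c3_def)
  define q where "q = c / (2 * (1 + c))"
  have q: "0 < q" "q < 1 / 2" "1 / (1 - 2 * q) = 1 + c"
    using c0 by (auto simp: q_def field_simps)
  have "?N * q ^ k \<le> (\<Sum>j\<in>{- int k..int k}. q ^ nat \<bar>j\<bar>) ^ n"
    using card_weight_le[of "{..<n}" "{- int k..int k}" q "\<lambda>j. nat \<bar>j\<bar>" k] q by simp
  also have "\<dots> \<le> (1 + c) ^ n"
    using sum_power_nat_abs_le[OF q(1,2), of k] q
    by (intro power_mono) (auto intro: sum_nonneg)
  finally have "?N \<le> (1 / q) ^ k * (1 + c) ^ n"
    using q(1) by (simp add: field_simps)
  also have "\<dots> = exp (k * ln (1 / q) + n * ln (1 + c))"
    using q(1) c0 by (simp add: exp_add exp_of_nat_mult)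
  \<comment> \<open>Here \<open>q < 1\<close> makes \<open>ln (1 / q)\<close> nonnegative, so
    \<open>k\<close> may be replaced by \<open>c * n\<close>.\<close>
  also have "\<dots> \<le> exp (c * n * ln (1 / q) + n * ln (1 + c))"
    using k q by (intro exp_le_cancel_iff[THEN iffD2] add_right_mono mult_right_mono) auto
  also have "c * n * ln (1 / q) + n * ln (1 + c) = n * ln 2"
  proof -
    have "ln (1 / q) = ln (2 * (1 + c)) - ln c"
      unfolding q_def divide_divide_eq_right mult_1 using c0 by (intro ln_divide_pos) auto
    then have "ln (1 / q) = ln 2 + ln (1 + c) - ln c"
      using ln_mult_pos[of 2 "1 + c"] c0 by simp
    moreover have "c3_log c = 0" using c by (simp add: is_c3_iff)
    ultimately have "c * ln (1 / q) + ln (1 + c) = ln 2"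
      by (simp only:) (simp add: c3_log_def algebra_simps)
    moreover have "c * n * ln (1 / q) + n * ln (1 + c) = n * (c * ln (1 / q) + ln (1 + c))"
      by (simp only: distrib_left mult.assoc mult.left_commute)
    ultimately show ?thesis by simp
  qed
  also have "exp (n * ln 2) = (2::real) ^ n"
    by (simp add: exp_of_nat_mult)
  finally have "real ?N \<le> real (2 ^ n)"
    by (simp only: of_nat_power of_nat_numeral)
  then show ?thesis by (simp only: of_nat_le_iff)
qed

text \<open>For \<open>y\<close> of \<open>l\<^sub>1\<close>-norm \<open>Y \<le> n + k\<close>, truncating all coordinates towards zero leaves a norm of at least
  \<open>Y - n\<close>; shrinking further to norm exactly \<open>\<lceil>Y - n\<rceil> \<le> k\<close> (or 0) gives an integer vector at distance
  at most \<open>n\<close> from \<open>y\<close>.\<close>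

lemma l1_cover_int_vectors:
  fixes n k m :: nat
  assumes n: "n > 0"
    and card: "card {z \<in> {..<n} \<rightarrow>\<^sub>E {- int k..int k}. (\<Sum>i<n. nat \<bar>z i\<bar>) \<le> k} \<le> m"
  shows "l1_cover {..<n} m (n / (n + k))"
proof -
  define Z where "Z = {z \<in> {..<n} \<rightarrow>\<^sub>E {- int k..int k}. (\<Sum>i<n. nat \<bar>z i\<bar>) \<le> k}"
  \<comment> \<open>Scaling by \<open>d\<close> turns the unit ball into the ball of radius
    \<open>n + k\<close>, and the desired radius \<open>n / (n + k)\<close> into
    \<open>n\<close>.\<close>
  define d where "d = real n + real k"
  have d: "d > 0" using n by (simp add: d_def)
  define U where "U = (\<lambda>z i. real_of_int (z i) / d) ` Z"
  have finZ: "finite Z"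
    unfolding Z_def
    by (rule finite_subset[of _ "{..<n} \<rightarrow>\<^sub>E {- int k..int k}"]) (auto intro: finite_PiE)
  have "card U \<le> m"
    using card card_image_le[OF finZ] order_trans unfolding U_def Z_def by blast
  moreover have "\<exists>u\<in>U. (\<Sum>i<n. \<bar>x i - u i\<bar>) \<le> n / (n + k)"
    if x: "(\<Sum>i<n. \<bar>x i\<bar>) \<le> 1" for x
  proof -
    define y where "y i = d * x i" for i
    define Y where "Y = (\<Sum>i<n. \<bar>y i\<bar>)"
    have "Y = d * (\<Sum>i<n. \<bar>x i\<bar>)"
      using d by (simp add: Y_def y_def abs_mult sum_distrib_left)
    then have Y: "Y \<le> d" using x d by simp
    define s where "s = nat \<lceil>Y - n\<rceil>"
    have s_ge: "Y - n \<le> s" by (simp add: s_def) linarith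
    have s_le: "s \<le> k"
      using Y by (simp add: s_def d_def nat_le_iff ceiling_le_iff)
    have "Y - n = (\<Sum>i<n. \<bar>y i\<bar> - 1)"
      by (simp add: Y_def sum_subtractf)
    also have "\<dots> \<le> (\<Sum>i<n. real (nat \<lfloor>\<bar>y i\<bar>\<rfloor>))"
      by (intro sum_mono) linarith
    finally have "Y - n \<le> real (\<Sum>i<n. nat \<lfloor>\<bar>y i\<bar>\<rfloor>)" by simp
    then have "s \<le> (\<Sum>i<n. nat \<lfloor>\<bar>y i\<bar>\<rfloor>)"
      unfolding s_def nat_le_iff ceiling_le_iff by simp
    then obtain g where g: "\<And>i. i < n \<Longrightarrow> g i \<le> nat \<lfloor>\<bar>y i\<bar>\<rfloor>" "(\<Sum>i<n. g i) = s"
      using sum_subvector[of "{..<n}" s "\<lambda>i. nat \<lfloor>\<bar>y i\<bar>\<rfloor>"] by auto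
    \<comment> \<open>Copying the signs of \<open>y\<close> makes every coordinate of the distance
      equal to the difference of the absolute values.\<close>
    define z where "z = (\<lambda>i\<in>{..<n}. if y i < 0 then - int (g i) else int (g i))"
    have zg: "nat \<bar>z i\<bar> = g i" if "i < n" for i
      using that by (simp add: z_def)
    have "g i \<le> k" if "i < n" for i
      using member_le_sum[of i "{..<n}" g] that g(2) s_le by auto
    then have "z \<in> Z"
      using zg g(2) s_le by (auto simp: Z_def z_def)
    moreover have "(\<Sum>i<n. \<bar>x i - z i / d\<bar>) \<le> n / (n + k)"
    proof -
      have "\<bar>x i - z i / d\<bar> = (\<bar>y i\<bar> - g i) / d" if i: "i < n" for i
      proof -
        have "real (g i) \<le> \<bar>y i\<bar>" using g(1)[OF i] by linarith
        then have "\<bar>y i - z i\<bar> = \<bar>y i\<bar> - g i"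
          using i by (simp add: z_def)
        moreover have "x i - z i / d = (y i - z i) / d"
          using d by (simp add: y_def field_simps)
        ultimately show ?thesis using d by simp
      qed
      then have "(\<Sum>i<n. \<bar>x i - z i / d\<bar>) = (\<Sum>i<n. (\<bar>y i\<bar> - g i) / d)"
        by (intro sum.cong) auto
      also have "\<dots> = (Y - s) / d"
        by (simp add: Y_def sum_divide_distrib[symmetric] sum_subtractf flip: g(2))
      also have "\<dots> \<le> n / d"
        using s_ge d by (intro divide_right_mono) auto
      finally show ?thesis by (simp add: d_def)
    qed
    ultimately show ?thesis
      unfolding U_def by (intro bexI[of _ "\<lambda>i. z i / d"]) auto
  qed
  ultimately show ?thesis
    unfolding l1_cover_def using finZ by (intro exI[of _ U]) (auto simp: U_def)
qed

section \<open>The limit\<close>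

text \<open>Let \<open>L\<close> be the limit of a monotone subsequence. Late terms of the
  subsequence stay below \<open>g n + e\<close>, so \<open>g n \<ge> L - e\<close> for all late
  \<open>n\<close>; conversely, one late term of the subsequence close to \<open>L\<close> bounds
  all sufficiently late values from above.\<close>

lemma convergent_if_eventually_le_earlier:
  fixes g :: "nat \<Rightarrow> real"
  assumes bnd: "\<And>n. n \<ge> 1 \<Longrightarrow> \<bar>g n\<bar> \<le> b"
    and step: "\<And>e. e > 0 \<Longrightarrow> \<exists>N. \<forall>n\<ge>N. \<forall>\<^sub>F M in sequentially. g M \<le> g n + e"
  shows "convergent g"
proof -
  \<comment> \<open>The successor keeps the indices in the range where \<open>bnd\<close>
    applies.\<close>
  obtain h :: "nat \<Rightarrow> nat" where h: "strict_mono h" "monoseq (\<lambda>j. g (Suc (h j)))"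
    using seq_monosub[of "\<lambda>n. g (Suc n)"] by blast
  have "Bseq (\<lambda>j. g (Suc (h j)))"
    using bnd by (intro BseqI'[of _ b]) simp
  then obtain L where L: "(\<lambda>j. g (Suc (h j))) \<longlonglongrightarrow> L"
    using h(2) Bseq_monoseq_convergent by (auto simp: convergent_def)
  have hj: "filterlim (\<lambda>j. Suc (h j)) at_top sequentially"
    using filterlim_subseq[OF h(1)] filterlim_Suc filterlim_compose by blast
  have "g \<longlonglongrightarrow> L"
  proof (rule order_tendstoI)
    fix y assume y: "y < L"
    define e where "e = (L - y) / 3"
    have e: "e > 0" using y by (simp add: e_def)
    obtain N where N: "\<And>n. n \<ge> N \<Longrightarrow> \<forall>\<^sub>F M in sequentially. g M \<le> g n + e"
      using step[OF e] by blast
    have "y < g n" if "n \<ge> N" for n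
    proof -
      have "\<forall>\<^sub>F j in sequentially. g (Suc (h j)) \<le> g n + e"
        using filterlim_iff[THEN iffD1, OF hj] N[OF that] by blast
      then have "L \<le> g n + e"
        by (rule tendsto_upperbound[OF L]) simp
      then show ?thesis using y by (simp add: e_def field_simps)
    qed
    then show "\<forall>\<^sub>F n in sequentially. y < g n"
      using eventually_sequentially by blast
  next
    fix y assume y: "L < y"
    define e where "e = (y - L) / 2"
    have e: "e > 0" using y by (simp add: e_def)
    obtain N where N: "\<And>n. n \<ge> N \<Longrightarrow> \<forall>\<^sub>F M in sequentially. g M \<le> g n + e"
      using step[OF e] by blast
    have "\<forall>\<^sub>F j in sequentially. g (Suc (h j)) < L + e"
      using order_tendstoD(2)[OF L, of "L + e"] e by simp
    moreover have "\<forall>\<^sub>F j in sequentially. Suc (h j) \<ge> N"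
      using hj by (simp add: filterlim_at_top)
    ultimately have ev: "\<forall>\<^sub>F j in sequentially. g (Suc (h j)) < L + e \<and> Suc (h j) \<ge> N"
      by eventually_elim auto
    then obtain j where j: "g (Suc (h j)) < L + e" "Suc (h j) \<ge> N"
      using eventually_happens'[OF sequentially_bot ev] by blast
    from N[OF j(2)] show "\<forall>\<^sub>F n in sequentially. g n < y"
      by eventually_elim (use j(1) in \<open>simp add: e_def field_simps\<close>)
  qed
  then show ?thesis by (auto simp: convergent_def)
qed

text \<open>Since the functional is at most 1, transferring a cover to large dimensions costs at
  most \<open>2 / k\<close>, which is at most \<open>e\<close> for \<open>k\<close> large.\<close>

lemma convergent_hadwiger_gamma_cross_polytope:
  "convergent (\<lambda>n. hadwiger_gamma n (2 ^ n) (cross_polytope n))"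
proof -
  define g where "g n = hadwiger_gamma n (2 ^ n) (cross_polytope n)" for n
  have g: "0 < g n" "l1_cover {..<n} (2 ^ n) (g n)"
    "\<And>r. 0 < r \<Longrightarrow> l1_cover {..<n} (2 ^ n) r \<Longrightarrow> g n \<le> r" if "n \<ge> 1" for n
    using Least_l1_cover[of "{..<n}" "2 ^ n"] that
    by (auto simp: g_def hadwiger_gamma_cross_polytope lessThan_empty_iff)
  have g1: "g n \<le> 1" if "n \<ge> 1" for n
    using g(3)[OF that, of 1] l1_cover_one[of "2 ^ n" "{..<n}"] by simp
  have "convergent g"
  proof (rule convergent_if_eventually_le_earlier)
    show "\<bar>g n\<bar> \<le> 1" if "n \<ge> 1" for n
      using g(1)[OF that] g1[OF that] by simp
    fix e :: real assume e: "e > 0"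
    obtain k0 :: nat where k0: "2 / e < k0" using reals_Archimedean2 by blast
    define k where "k = k0 + 2"
    have k: "k \<ge> 2" "2 / k \<le> e"
      using k0 e by (auto simp: k_def field_simps)
    have "\<forall>\<^sub>F M in sequentially. g M \<le> g n + e" if n: "n \<ge> k * (k + 2)" for n
    proof -
      have "1 \<le> k * (k + 2)" using k(1) by simp
      then have n1: "n \<ge> 1" using n by linarith
      let ?r = "g n * (1 + 1 / k) + 1 / k"
      have r: "0 < ?r" using g(1)[OF n1] by (intro add_pos_nonneg mult_pos_pos) auto
      have "g n * (1 / k) \<le> 1 * (1 / k)"
        using g1[OF n1] by (intro mult_right_mono) auto
      then have "?r \<le> g n + 2 / k" by (simp add: distrib_left)
      then have r_le: "?r \<le> g n + e" using k(2) by linarith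
      have "\<forall>\<^sub>F M in sequentially. M \<ge> 1 \<and> l1_cover {..<M} (2 ^ M) ?r"
        using l1_cover_eventually[OF k(1) n g(1,2)[OF n1]] eventually_ge_at_top
        by (intro eventually_conj)
      then show ?thesis
      proof eventually_elim
        case (elim M)
        then have "g M \<le> ?r" using g(3)[of M ?r] r by blast
        then show ?case using r_le by linarith
      qed
    qed
    then show "\<exists>N. \<forall>n\<ge>N. \<forall>\<^sub>F M in sequentially. g M \<le> g n + e" by blast
  qed
  then show ?thesis by (simp add: g_def[abs_def])
qed

text \<open>Rounding \<open>c * n\<close> down to the integer \<open>k\<close> loses less than 1,
  hence the term \<open>1 / n\<close> in the denominator.\<close>

lemma hadwiger_gamma_cross_polytope_le:
  assumes c: "is_c3 c" and n: "n \<ge> 1"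
  shows "hadwiger_gamma n (2 ^ n) (cross_polytope n) \<le> 1 / (1 + c - 1 / n)"
proof -
  have c0: "c > 0" using c by (simp add: is_c3_def)
  define k where "k = nat \<lfloor>c * n\<rfloor>"
  have "c * n \<ge> 0" using c0 by simp
  then have k: "real k \<le> c * n" "c * n - 1 \<le> real k"
    unfolding k_def by linarith+
  have "l1_cover {..<n} (2 ^ n) (n / (n + k))"
    using n by (intro l1_cover_int_vectors card_int_vectors_le[OF c k(1)]) auto
  then have "hadwiger_gamma n (2 ^ n) (cross_polytope n) \<le> n / (n + k)"
    using n Least_l1_cover(3)[of "{..<n}" "2 ^ n" "n / (n + k)"]
    by (simp add: hadwiger_gamma_cross_polytope lessThan_empty_iff)
  also have "real n / (n + k) \<le> n / (n + (c * n - 1))"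
  proof (rule divide_left_mono)
    \<comment> \<open>As \<open>n \<ge> 1\<close>, the denominator \<open>n + (c * n - 1)\<close> is
      at least \<open>c * n\<close>, so it is positive even for \<open>n = 1\<close>.\<close>
    have "c * n > 0" using c0 n by simp
    then show "0 < real (n + k) * (n + (c * n - 1))"
      using n by (intro mult_pos_pos) auto
  qed (use k in auto)
  also have "n + (c * n - 1) = n * (1 + c - 1 / n)"
    using n by (simp add: field_simps)
  also have "n / (n * (1 + c - 1 / n)) = 1 / (1 + c - 1 / n)"
    using n by simp
  finally show ?thesis .
qed

theorem theorem1p2:
  shows "(\<exists>!c. is_c3 c) \<and> \<bar>c3 - 0.2056\<bar> < 0.00005 \<and>
         (\<exists>!c. is_c4 c) \<and> \<bar>c4 - 0.2271\<bar> < 0.00005 \<and>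
         (\<exists>c2::real. c3 \<le> c2 \<and> c2 \<le> c4 \<and>
            convergent (\<lambda>n. hadwiger_gamma n (2 ^ n) (cross_polytope n)) \<and>
            lim (\<lambda>n. hadwiger_gamma n (2 ^ n) (cross_polytope n)) \<le> 1 / (1 + c2))"
proof -
  obtain a where a: "37 / 180 < a" "a < 22 / 107" "is_c3 a" "\<And>d. is_c3 d \<Longrightarrow> d = a"
    by (rule c3_root) blast
  obtain b where b: "47 / 207 < b" "b < 62 / 273" "is_c4 b" "\<And>d. is_c4 d \<Longrightarrow> d = b"
    by (rule c4_root) blast
  have c3: "c3 = a" unfolding c3_def by (rule the_equality[where P = is_c3, OF a(3,4)])
  have c4: "c4 = b" unfolding c4_def by (rule the_equality[where P = is_c4, OF b(3,4)])
  let ?g = "\<lambda>n. hadwiger_gamma n (2 ^ n) (cross_polytope n)"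
  have "lim ?g \<le> 1 / (1 + a)"
  proof (rule LIMSEQ_le)
    show "?g \<longlonglongrightarrow> lim ?g"
      using convergent_hadwiger_gamma_cross_polytope by (simp add: convergent_LIMSEQ_iff)
    show "(\<lambda>n. 1 / (1 + a - 1 / real n)) \<longlonglongrightarrow> 1 / (1 + a)"
    proof -
      have "(\<lambda>n. 1 / (1 + a - 1 / real n)) \<longlonglongrightarrow> 1 / (1 + a - 0)"
        using a(1) by (intro tendsto_intros lim_1_over_n) auto
      then show ?thesis by simp
    qed
    show "\<exists>N. \<forall>n\<ge>N. ?g n \<le> 1 / (1 + a - 1 / real n)"
      using hadwiger_gamma_cross_polytope_le[OF a(3)] by blast
  qed
  moreover have "\<exists>!c. is_c3 c" "\<exists>!c. is_c4 c"
    using a(3,4) b(3,4) by (blast, blast)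
  \<comment> \<open>The brackets lie inside the error intervals, and they are disjoint, which orders
    the two roots.\<close>
  moreover have "\<bar>a - 0.2056\<bar> < 0.00005" "\<bar>b - 0.2271\<bar> < 0.00005" "a \<le> b"
    unfolding abs_diff_less_iff using a(1,2) b(1,2) by simp_all
  ultimately show ?thesis
    \<comment> \<open>The witness for \<open>c2\<close> is \<open>a\<close>, the lower end of the
      permitted range.\<close>
    unfolding c3 c4 using convergent_hadwiger_gamma_cross_polytope
    by (intro conjI exI[of _ a]) auto
qed

end
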